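(* Let $\alpha,\beta,\gamma\in(0,1)$ and, for $\bm x=(x_1,x_2,x_3)\in[0,\infty)^3$, let $$g(\bm x)=x_2+\left[\left\{\left(x_1^{1/\alpha}+x_2^{1/\alpha}\right)^\alpha-x_2\right\}^{1/\gamma}+\left\{\left(x_2^{1/\beta}+x_3^{1/\beta}\right)^\beta-x_2\right\}^{1/\gamma}\right]^\gamma,$$ the gauge function of the trivariate vine copula whose pair copulas $C_{12},C_{23},C_{13|2}$ are inverted logistic with parameters $\alpha,\beta,\gamma$ respectively. Let $\eta_{\{1,3\}}=\left\{\min_{x_1,x_3\ge1,\;x_2\ge0}g(x_1,x_2,x_3)\right\}^{-1}$. Then the equation $$1+\left[\left\{(1+v^{1/\alpha})^\alpha-v\right\}^{1/\gamma}+\left\{(1+v^{1/\beta})^\beta-v\right\}^{1/\gamma}\right]^{\gamma-1}\left[\left\{(1+v^{-1/\alpha})^{\alpha-1}-1\right\}\left\{(1+v^{1/\alpha})^\alpha-v\right\}^{-1+1/\gamma}+\left\{(1+v^{-1/\beta})^{\beta-1}-1\right\}\left\{(1+v^{1/\beta})^\beta-v\right\}^{-1+1/\gamma}\right]=0$$ (that is, $\frac{d}{dv}g(1,v,1)=0$) has a unique solution $v>0$, this solution lies in $(0,1)$, and for this $v$ $$\eta_{\{1,3\}}=\left(v+\left[\left\{(1+v^{1/\alpha})^\alpha-v\right\}^{1/\gamma}+\left\{(1+v^{1/\beta})^\beta-v\right\}^{1/\gamma}\right]^\gamma\right)^{-1}.$$ Moreover, if $\alpha=\beta$, then $$v=\left\{(1-2^{-\gamma})^{-1/(1-\alpha)}-1\right\}^{-\alpha},\qquad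 \eta_{\{1,3\}}=\frac{\left\{(1-2^{-\gamma})^{-1/(1-\alpha)}-1\right\}^\alpha}{1-2^\gamma+2^\gamma(1-2^{-\gamma})^{-\alpha/(1-\alpha)}}.$$
   Context: The inverted logistic copula is the inverted extreme value copula with exponent measure $V(x,y)=(x^{-1/\alpha}+y^{-1/\alpha})^\alpha$. The gauge function of a joint density $f$ with standard exponential margins is the function $g$, homogeneous of order 1, with $-\ln f(t\bm x)\sim tg(\bm x)$ as $t\to\infty$. The coefficient of tail dependence $\eta_{\{1,3\}}$ of $(X_1,X_3)$ is taken in its gauge-function form as in the claim. *)

theory Defs
  imports "HOL-Analysis.Analysis" "HOL-Library.Landau_Symbols"
begin

text \<open>
  The inverted copula of an extreme value copula
  \<open>exp (- V (- 1 / ln u, - 1 / ln v))\<close> is its survival copula.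
\<close>

definition inverted_ev_copula ::
    "(real \<Rightarrow> real \<Rightarrow> real) \<Rightarrow> real \<Rightarrow> real \<Rightarrow> real" where
  "inverted_ev_copula V u v = u + v - 1 + exp (- V (- 1 / ln (1 - u)) (- 1 / ln (1 - v)))"

definition logistic_exponent_measure :: "real \<Rightarrow> real \<Rightarrow> real \<Rightarrow> real" where
  "logistic_exponent_measure \<alpha> x y = (x powr (- 1 / \<alpha>) + y powr (- 1 / \<alpha>)) powr \<alpha>"

definition inverted_logistic_copula :: "real \<Rightarrow> real \<Rightarrow> real \<Rightarrow> real" where
  "inverted_logistic_copula \<alpha> = inverted_ev_copula (logistic_exponent_measure \<alpha>)"

definition copula_density :: "(real \<Rightarrow> real \<Rightarrow> real) \<Rightarrow> real \<Rightarrow> real \<Rightarrow> real" where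
  "copula_density C u v = deriv (\<lambda>s. deriv (\<lambda>t. C s t) v) u"

text \<open>
  Trivariate vine with conditioning variable 2: the conditional distribution functions of
  \<open>U\<^sub>1\<close> and \<open>U\<^sub>3\<close> given \<open>U\<^sub>2 = u\<^sub>2\<close> are the partial derivatives of \<open>C12\<close> and \<open>C23\<close> in \<open>u\<^sub>2\<close>, and
  \<open>C13\<close> stands for the copula of (1,3) given 2.
\<close>

definition vine_copula_density ::
    "(real \<Rightarrow> real \<Rightarrow> real) \<Rightarrow> (real \<Rightarrow> real \<Rightarrow> real) \<Rightarrow> (real \<Rightarrow> real \<Rightarrow> real) \<Rightarrow>
     real \<times> real \<times> real \<Rightarrow> real" where
  "vine_copula_density C12 C23 C13 = (\<lambda>(u1, u2, u3).
     copula_density C12 u1 u2 * copula_density C23 u2 u3 *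
     copula_density C13 (deriv (\<lambda>s. C12 u1 s) u2) (deriv (\<lambda>s. C23 s u3) u2))"

definition exponential_margins_density ::
    "(real \<times> real \<times> real \<Rightarrow> real) \<Rightarrow> real \<times> real \<times> real \<Rightarrow> real" where
  "exponential_margins_density c = (\<lambda>(x1, x2, x3).
     c (1 - exp (- x1), 1 - exp (- x2), 1 - exp (- x3)) * exp (- x1) * exp (- x2) * exp (- x3))"

text \<open>
  The asymptotic relation is required on the open orthant only: on its boundary the density may
  vanish (as it does for the inverted logistic vine), and there the gauge is fixed by continuity.
\<close>

definition is_gauge_function ::
    "(real \<times> real \<times> real \<Rightarrow> real) \<Rightarrow> (real \<times> real \<times> real \<Rightarrow> real) \<Rightarrow> bool" where
  "is_gauge_function f g \<longleftrightarrow>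
     continuous_on ({0..} \<times> {0..} \<times> {0..}) g \<and>
     (\<forall>x \<in> {0..} \<times> {0..} \<times> {0..}. \<forall>t > 0. g (t *\<^sub>R x) = t * g x) \<and>
     (\<forall>x \<in> {0<..} \<times> {0<..} \<times> {0<..}. (\<lambda>t. - ln (f (t *\<^sub>R x))) \<sim>[at_top] (\<lambda>t. t * g x))"

definition vine_gauge :: "real \<Rightarrow> real \<Rightarrow> real \<Rightarrow> real \<times> real \<times> real \<Rightarrow> real" where
  "vine_gauge \<alpha> \<beta> \<gamma> = (\<lambda>(x1, x2, x3).
     x2 + (((x1 powr (1/\<alpha>) + x2 powr (1/\<alpha>)) powr \<alpha> - x2) powr (1/\<gamma>)
         + ((x2 powr (1/\<beta>) + x3 powr (1/\<beta>)) powr \<beta> - x2) powr (1/\<gamma>)) powr \<gamma>)"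

definition tail_region_13 :: "(real \<times> real \<times> real) set" where
  "tail_region_13 = {1..} \<times> {0..} \<times> {1..}"

text \<open>The \<open>LEAST\<close> element of the image is a genuine minimum: it is unspecified if not attained.\<close>

definition eta_13 :: "(real \<times> real \<times> real \<Rightarrow> real) \<Rightarrow> real" where
  "eta_13 g = inverse (LEAST m. m \<in> g ` tail_region_13)"

definition stationarity_lhs :: "real \<Rightarrow> real \<Rightarrow> real \<Rightarrow> real \<Rightarrow> real" where
  "stationarity_lhs \<alpha> \<beta> \<gamma> v =
     1 + (((1 + v powr (1/\<alpha>)) powr \<alpha> - v) powr (1/\<gamma>)
        + ((1 + v powr (1/\<beta>)) powr \<beta> - v) powr (1/\<gamma>)) powr (\<gamma> - 1)
       * (((1 + v powr (- 1/\<alpha>)) powr (\<alpha> - 1) - 1) * ((1 + v powr (1/\<alpha>)) powr \<alpha> - v) powr (- 1 + 1/\<gamma>)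
        + ((1 + v powr (- 1/\<beta>)) powr (\<beta> - 1) - 1) * ((1 + v powr (1/\<beta>)) powr \<beta> - v) powr (- 1 + 1/\<gamma>))"

end

theory Submission
  imports Defs
begin

text \<open>
  Write \<open>N \<delta> a b = (a powr (1/\<delta>) + b powr (1/\<delta>)) powr \<delta>\<close>, the norm of \<open>(a, b)\<close> with exponent
  \<open>1/\<delta> > 1\<close>. In exponential coordinates the inverted logistic copula is governed by
  \<open>exp (- N \<delta> x y)\<close>, and the gauge is
  \<open>x2 + N \<gamma> (N \<alpha> x1 x2 - x2) (N \<beta> x3 x2 - x2)\<close>.

  \<^emph>\<open>Gauge.\<close> The conditional survival probability of the first component given the second
  is \<open>exp (- a)\<close> with \<open>a = N \<alpha> x1 x2 - x2 - ln s\<close>, where \<open>s\<close> is the partial derivative of \<open>N \<alpha>\<close>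
  in its second argument; likewise for the third component, with excess \<open>b\<close>. When the three pair
  densities are multiplied, the exponents cancel except for \<open>x2 + N \<gamma> a b\<close>, and the remaining
  factor is built from first and second derivatives of the norms
  (\<open>exponential_margins_density_vine\<close>). Along a ray \<open>t x\<close> the first derivatives do not change and
  the second ones decay like \<open>1/t\<close>, so that factor converges to a positive limit and its logarithm
  is negligible against \<open>t\<close>, while \<open>a / t\<close> loses its logarithmic term.

  \<^emph>\<open>Minimum.\<close> The gauge is nondecreasing in \<open>x1\<close> and \<open>x3\<close>, so only \<open>h v = g (1, v, 1)\<close> matters.
  Each excess \<open>N \<delta> 1 v - v\<close> is strictly convex in \<open>v\<close>, and the norm \<open>N \<gamma>\<close> is convex and strictly
  increasing in both arguments. Combining the two tangent inequalities shows that at a stationary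
  point \<open>h\<close> is strictly smaller than at any other point (\<open>vine_gauge_diagonal_strict_min\<close>); two
  stationary points would each beat the other, so there is at most one, and it gives the minimum.
  There is one in \<open>(0, 1)\<close> because \<open>h'\<close> tends to \<open>1 - 2 powr \<gamma> < 0\<close> at \<open>0\<close> and is positive at \<open>1\<close>.
  For \<open>\<alpha> = \<beta>\<close> both excesses agree and \<open>h' = 0\<close> can be solved for \<open>v\<close>.
\<close>

section \<open>The logistic norm and its derivatives\<close>

definition logistic_norm :: "real \<Rightarrow> real \<Rightarrow> real \<Rightarrow> real" where
  "logistic_norm \<alpha> a b = (a powr (1/\<alpha>) + b powr (1/\<alpha>)) powr \<alpha>"

text \<open>
  The partial derivative of the norm in its second argument, written as a function of the ratio of
  the arguments so that its invariance under scaling is visible.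
\<close>

definition logistic_slope :: "real \<Rightarrow> real \<Rightarrow> real \<Rightarrow> real" where
  "logistic_slope \<alpha> a b = (1 + (a / b) powr (1/\<alpha>)) powr (\<alpha> - 1)"

text \<open>
  The negative of the mixed second derivative of the norm; it is homogeneous of order \<open>-1\<close>.
\<close>

definition logistic_bend :: "real \<Rightarrow> real \<Rightarrow> real \<Rightarrow> real" where
  "logistic_bend \<alpha> a b =
     (1 - \<alpha>) / \<alpha> * (1 + (a / b) powr (1/\<alpha>)) powr (\<alpha> - 2) * (a / b) powr (1/\<alpha> - 1) / b"

lemma logistic_norm_commute: "logistic_norm \<alpha> a b = logistic_norm \<alpha> b a"
  by (simp add: logistic_norm_def add.commute)

lemma logistic_norm_nonneg: "0 \<le> logistic_norm \<alpha> a b"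
  by (simp add: logistic_norm_def)

lemma logistic_norm_mono:
  assumes "0 < \<alpha>" "0 \<le> a" "a \<le> a'" "0 \<le> b" "b \<le> b'"
  shows "logistic_norm \<alpha> a b \<le> logistic_norm \<alpha> a' b'"
  unfolding logistic_norm_def
  by (intro powr_mono2 add_mono) (use assms in auto)

lemma logistic_norm_ge:
  assumes "0 < \<alpha>" "0 \<le> a" "0 \<le> b"
  shows "b \<le> logistic_norm \<alpha> a b"
proof -
  have "b = (b powr (1/\<alpha>)) powr \<alpha>" using assms by (simp add: powr_powr)
  also have "\<dots> \<le> logistic_norm \<alpha> a b"
    unfolding logistic_norm_def by (intro powr_mono2) (use assms in auto)
  finally show ?thesis .
qed

lemma logistic_norm_gt:
  assumes "0 < \<alpha>" "0 < a" "0 \<le> b"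
  shows "b < logistic_norm \<alpha> a b"
proof -
  have "b = (b powr (1/\<alpha>)) powr \<alpha>" using assms by (simp add: powr_powr)
  also have "\<dots> < logistic_norm \<alpha> a b"
    unfolding logistic_norm_def by (intro powr_less_mono2) (use assms in auto)
  finally show ?thesis .
qed

lemma logistic_norm_scale:
  assumes "0 < \<alpha>" "0 < t" "0 \<le> a" "0 \<le> b"
  shows "logistic_norm \<alpha> (t * a) (t * b) = t * logistic_norm \<alpha> a b"
proof -
  have "(t * a) powr (1/\<alpha>) + (t * b) powr (1/\<alpha>) = t powr (1/\<alpha>) * (a powr (1/\<alpha>) + b powr (1/\<alpha>))"
    using assms by (simp add: powr_mult algebra_simps)
  then show ?thesis
    using assms by (simp add: logistic_norm_def powr_mult powr_powr)
qed

lemma logistic_slope_pos: "0 < logistic_slope \<alpha> a b"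
proof -
  have "0 < 1 + (a / b) powr (1/\<alpha>)" by (simp add: add_pos_nonneg)
  then show ?thesis by (simp add: logistic_slope_def)
qed

lemma logistic_slope_less_1:
  assumes "\<alpha> < 1" "0 < a" "0 < b"
  shows "logistic_slope \<alpha> a b < 1"
proof -
  have "(1 + (a / b) powr (1/\<alpha>)) powr (\<alpha> - 1) < (1 + (a / b) powr (1/\<alpha>)) powr 0"
    by (intro powr_less_mono) (use assms in auto)
  moreover have "1 + (a / b) powr (1/\<alpha>) \<noteq> 0"
    by (metis add_pos_nonneg less_irrefl powr_ge_zero zero_less_one)
  ultimately show ?thesis by (simp add: logistic_slope_def)
qed

lemma logistic_slope_scale: "0 < t \<Longrightarrow> logistic_slope \<alpha> (t * a) (t * b) = logistic_slope \<alpha> a b"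
  by (simp add: logistic_slope_def)

lemma logistic_bend_nonneg:
  assumes "0 < \<alpha>" "\<alpha> < 1" "0 < b"
  shows "0 \<le> logistic_bend \<alpha> a b"
  using assms by (simp add: logistic_bend_def)

lemma logistic_bend_scale: "0 < t \<Longrightarrow> logistic_bend \<alpha> (t * a) (t * b) = logistic_bend \<alpha> a b / t"
  by (simp add: logistic_bend_def)

lemma logistic_slope_eq:
  assumes "0 < \<alpha>" "0 < a" "0 < b"
  shows "logistic_slope \<alpha> a b = (a powr (1/\<alpha>) + b powr (1/\<alpha>)) powr (\<alpha> - 1) * b powr (1/\<alpha> - 1)"
proof -
  have "a powr (1/\<alpha>) + b powr (1/\<alpha>) = b powr (1/\<alpha>) * (1 + (a / b) powr (1/\<alpha>))"
    using assms by (simp add: powr_divide field_simps)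
  then have "(a powr (1/\<alpha>) + b powr (1/\<alpha>)) powr (\<alpha> - 1)
      = b powr (1/\<alpha> * (\<alpha> - 1)) * logistic_slope \<alpha> a b"
    using assms by (simp add: powr_mult powr_powr logistic_slope_def)
  moreover have "b powr (1/\<alpha> * (\<alpha> - 1)) * b powr (1/\<alpha> - 1) = 1"
    using assms by (simp flip: powr_add add: field_simps)
  ultimately show ?thesis
    by (metis mult.assoc mult.commute mult_1)
qed

lemma DERIV_logistic_norm:
  assumes "0 < \<alpha>" "0 < f x" "0 < g x"
    and "(f has_real_derivative f') (at x)" "(g has_real_derivative g') (at x)"
  shows "((\<lambda>y. logistic_norm \<alpha> (f y) (g y)) has_real_derivative
    logistic_slope \<alpha> (g x) (f x) * f' + logistic_slope \<alpha> (f x) (g x) * g') (at x)"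
proof -
  have S: "0 < f x powr (1/\<alpha>) + g x powr (1/\<alpha>)" using assms by (simp add: add_pos_nonneg)
  have "((\<lambda>y. logistic_norm \<alpha> (f y) (g y)) has_real_derivative
      \<alpha> * (f x powr (1/\<alpha>) + g x powr (1/\<alpha>)) powr (\<alpha> - 1) *
      (1/\<alpha> * f x powr (1/\<alpha> - 1) * f' + 1/\<alpha> * g x powr (1/\<alpha> - 1) * g')) (at x)"
    unfolding logistic_norm_def
    by (rule derivative_eq_intros refl S assms)+
  then show ?thesis
    using assms logistic_slope_eq[of \<alpha> "f x" "g x"] logistic_slope_eq[of \<alpha> "g x" "f x"]
    by (simp add: algebra_simps)
qed

lemma DERIV_logistic_slope:
  assumes "0 < \<alpha>" "0 < a" "0 < b"
  shows "((\<lambda>x. logistic_slope \<alpha> x b) has_real_derivative - logistic_bend \<alpha> a b) (at a)"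
proof -
  have S: "0 < 1 + (a / b) powr (1/\<alpha>)" by (simp add: add_pos_nonneg)
  have e: "\<alpha> - 1 - 1 = \<alpha> - 2" by simp
  have "((\<lambda>x. logistic_slope \<alpha> x b) has_real_derivative
      (\<alpha> - 1) * (1 + (a / b) powr (1/\<alpha>)) powr (\<alpha> - 1 - 1) *
      (1/\<alpha> * (a / b) powr (1/\<alpha> - 1) * (1 / b))) (at a)"
    unfolding logistic_slope_def
    by (rule derivative_eq_intros refl S | (use assms in simp))+
  then show ?thesis
    unfolding e by (rule back_subst[where P = "\<lambda>d. (_ has_real_derivative d) _"])
      (use assms in \<open>simp add: logistic_bend_def field_simps\<close>)
qed

text \<open>
  Euler's identity for a function that is homogeneous of order 1: the tangent plane of the norm at
  any point passes through the origin.
\<close>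

lemma logistic_norm_euler:
  assumes "0 < \<alpha>" "0 < a" "0 < b"
  shows "logistic_norm \<alpha> a b = a * logistic_slope \<alpha> b a + b * logistic_slope \<alpha> a b"
proof -
  define S where "S = a powr (1/\<alpha>) + b powr (1/\<alpha>)"
  have S: "S > 0" using assms by (simp add: S_def add_pos_nonneg)
  have *: "y * logistic_slope \<alpha> x y = S powr (\<alpha> - 1) * y powr (1/\<alpha>)"
    if "x > 0" "y > 0" "x powr (1/\<alpha>) + y powr (1/\<alpha>) = S" for x y
    using that assms powr_mult_base[of y "1/\<alpha> - 1"] by (simp add: logistic_slope_eq)
  have "logistic_norm \<alpha> a b = S powr (\<alpha> - 1 + 1)" by (simp add: logistic_norm_def S_def)
  also have "\<dots> = S powr (\<alpha> - 1) * S" unfolding powr_add using S by simp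
  also have "\<dots> = S powr (\<alpha> - 1) * a powr (1/\<alpha>) + S powr (\<alpha> - 1) * b powr (1/\<alpha>)"
    by (simp add: S_def distrib_left)
  also have "\<dots> = a * logistic_slope \<alpha> b a + b * logistic_slope \<alpha> a b"
    using *[of b a] *[of a b] assms by (simp add: S_def add.commute)
  finally show ?thesis .
qed

lemma logistic_slope_strict_mono:
  assumes "0 < \<alpha>" "\<alpha> < 1" "0 < u" "u < v"
  shows "logistic_slope \<alpha> 1 u < logistic_slope \<alpha> 1 v"
proof -
  have "(1 / v) powr (1/\<alpha>) < (1 / u) powr (1/\<alpha>)"
    by (intro powr_less_mono2) (use assms in \<open>auto simp: field_simps\<close>)
  then show ?thesis
    unfolding logistic_slope_def
    by (intro powr_less_mono2_neg) (use assms in \<open>auto simp: add_pos_nonneg\<close>)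
qed

lemma continuous_on_logistic_norm:
  assumes "0 < \<alpha>" "continuous_on S f" "continuous_on S g"
    and "\<And>x. x \<in> S \<Longrightarrow> 0 \<le> f x" "\<And>x. x \<in> S \<Longrightarrow> 0 \<le> g x"
  shows "continuous_on S (\<lambda>x. logistic_norm \<alpha> (f x) (g x))"
  unfolding logistic_norm_def
  by (intro continuous_on_powr' continuous_intros) (use assms in auto)

text \<open>
  Strict convexity of \<open>v \<mapsto> logistic_norm \<alpha> 1 v\<close>, by the mean value theorem, since its derivative
  increases strictly. The end point \<open>v = 0\<close> is included, although the derivative formula is not
  valid there, because continuity up to the boundary suffices.
\<close>

lemma logistic_norm_above_tangent:
  assumes "0 < \<alpha>" "\<alpha> < 1" "0 < u" "0 \<le> v" "v \<noteq> u"
  shows "logistic_norm \<alpha> 1 u + logistic_slope \<alpha> 1 u * (v - u) < logistic_norm \<alpha> 1 v"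
proof -
  have cont: "continuous_on {c..d} (\<lambda>y. logistic_norm \<alpha> 1 y)" if "0 \<le> c" for c d
    by (intro continuous_on_logistic_norm continuous_intros) (use assms that in auto)
  have D: "((\<lambda>y. logistic_norm \<alpha> 1 y) has_real_derivative logistic_slope \<alpha> 1 y) (at y)"
    if "0 < y" for y
    using DERIV_logistic_norm[of \<alpha> "\<lambda>_. 1" y "\<lambda>y. y" 0 1] that assms by simp
  have mvt: "\<exists>z. c < z \<and> z < d \<and>
      logistic_norm \<alpha> 1 d - logistic_norm \<alpha> 1 c = (d - c) * logistic_slope \<alpha> 1 z"
    if "0 \<le> c" "c < d" for c d
  proof -
    have "logistic_norm \<alpha> 1 differentiable at y" if "c < y" for y
      using D[of y] that \<open>0 \<le> c\<close> by (auto simp: real_differentiable_def)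
    then obtain l z where z: "c < z" "z < d" "DERIV (\<lambda>y. logistic_norm \<alpha> 1 y) z :> l"
        "logistic_norm \<alpha> 1 d - logistic_norm \<alpha> 1 c = (d - c) * l"
      using MVT[OF \<open>c < d\<close> cont[OF \<open>0 \<le> c\<close>]] by blast
    moreover have "l = logistic_slope \<alpha> 1 z"
      using z D[of z] that DERIV_unique by fastforce
    ultimately show ?thesis by blast
  qed
  show ?thesis
  proof (cases "u < v")
    case True
    then obtain z where z: "u < z" "z < v"
      "logistic_norm \<alpha> 1 v - logistic_norm \<alpha> 1 u = (v - u) * logistic_slope \<alpha> 1 z"
      using mvt[of u v] assms by auto
    have "(v - u) * logistic_slope \<alpha> 1 u < (v - u) * logistic_slope \<alpha> 1 z"
      using True z logistic_slope_strict_mono[of \<alpha> u z] assms by (intro mult_strict_left_mono) auto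
    with z show ?thesis by (simp add: algebra_simps)
  next
    case False
    then obtain z where z: "v < z" "z < u"
      "logistic_norm \<alpha> 1 u - logistic_norm \<alpha> 1 v = (u - v) * logistic_slope \<alpha> 1 z"
      using mvt[of v u] assms by auto
    have "(u - v) * logistic_slope \<alpha> 1 z < (u - v) * logistic_slope \<alpha> 1 u"
      using False z logistic_slope_strict_mono[of \<alpha> z u] assms by (intro mult_strict_left_mono) auto
    with z show ?thesis by (simp add: algebra_simps)
  qed
qed

text \<open>
  Hoelder's inequality in gradient form. By homogeneity it is the one-dimensional tangent
  inequality between the slopes \<open>b / a\<close> and \<open>d / c\<close>, rewritten with Euler's identity.
\<close>

lemma logistic_norm_ge_gradient:
  assumes "0 < \<alpha>" "\<alpha> < 1" "0 < a" "0 < b" "0 < c" "0 < d"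
  shows "logistic_slope \<alpha> b a * c + logistic_slope \<alpha> a b * d \<le> logistic_norm \<alpha> c d"
proof -
  define u v where "u = b / a" and "v = d / c"
  have uv: "0 < u" "0 < v" using assms by (auto simp: u_def v_def)
  have "logistic_norm \<alpha> 1 u + logistic_slope \<alpha> 1 u * (v - u) \<le> logistic_norm \<alpha> 1 v"
    using logistic_norm_above_tangent[of \<alpha> u v] assms uv by (cases "v = u") auto
  moreover have "logistic_norm \<alpha> 1 u = logistic_slope \<alpha> u 1 + u * logistic_slope \<alpha> 1 u"
    using logistic_norm_euler[of \<alpha> 1 u] assms uv by simp
  ultimately have "logistic_slope \<alpha> u 1 + logistic_slope \<alpha> 1 u * v \<le> logistic_norm \<alpha> 1 v"
    by (simp add: algebra_simps)
  then have "c * (logistic_slope \<alpha> u 1 + logistic_slope \<alpha> 1 u * v) \<le> c * logistic_norm \<alpha> 1 v"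
    using assms by simp
  moreover have "c * logistic_norm \<alpha> 1 v = logistic_norm \<alpha> c d"
    using logistic_norm_scale[of \<alpha> c 1 v] assms uv by (simp add: v_def)
  moreover have "logistic_slope \<alpha> u 1 = logistic_slope \<alpha> b a" "logistic_slope \<alpha> 1 u = logistic_slope \<alpha> a b"
    using logistic_slope_scale[of a \<alpha> u 1] logistic_slope_scale[of a \<alpha> 1 u] assms by (auto simp: u_def)
  moreover have "c * (v * k) = d * k" for k using assms by (simp add: v_def)
  ultimately show ?thesis by (simp add: algebra_simps)
qed

section \<open>The gauge and its minimum\<close>

lemma vine_gauge_eq:
  "vine_gauge \<alpha> \<beta> \<gamma> (x1, x2, x3) =
     x2 + logistic_norm \<gamma> (logistic_norm \<alpha> x1 x2 - x2) (logistic_norm \<beta> x3 x2 - x2)"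
  by (simp add: vine_gauge_def logistic_norm_def add.commute)

lemma vine_gauge_pos:
  assumes "0 < \<alpha>" "0 < \<gamma>" "0 < x1" "0 < x2"
  shows "0 < vine_gauge \<alpha> \<beta> \<gamma> (x1, x2, x3)"
  using assms logistic_norm_nonneg by (simp add: vine_gauge_eq add_pos_nonneg)

lemma continuous_on_vine_gauge:
  assumes "0 < \<alpha>" "0 < \<beta>" "0 < \<gamma>"
  shows "continuous_on ({0..} \<times> {0..} \<times> {0..}) (vine_gauge \<alpha> \<beta> \<gamma>)"
proof -
  have eq: "vine_gauge \<alpha> \<beta> \<gamma> = (\<lambda>x. fst (snd x) +
      logistic_norm \<gamma> (logistic_norm \<alpha> (fst x) (fst (snd x)) - fst (snd x))
        (logistic_norm \<beta> (snd (snd x)) (fst (snd x)) - fst (snd x)))"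
    by (auto simp: fun_eq_iff vine_gauge_eq)
  show ?thesis
    unfolding eq
    by (intro continuous_on_logistic_norm continuous_intros)
      (use assms in \<open>auto intro: logistic_norm_ge\<close>)
qed

lemma vine_gauge_scale:
  assumes "0 < \<alpha>" "0 < \<beta>" "0 < \<gamma>" "x \<in> {0..} \<times> {0..} \<times> {0..}" "0 < t"
  shows "vine_gauge \<alpha> \<beta> \<gamma> (t *\<^sub>R x) = t * vine_gauge \<alpha> \<beta> \<gamma> x"
proof -
  obtain x1 x2 x3 where x: "x = (x1, x2, x3)" "0 \<le> x1" "0 \<le> x2" "0 \<le> x3"
    using assms by auto
  have "logistic_norm \<gamma> (t * (logistic_norm \<alpha> x1 x2 - x2)) (t * (logistic_norm \<beta> x3 x2 - x2))
      = t * logistic_norm \<gamma> (logistic_norm \<alpha> x1 x2 - x2) (logistic_norm \<beta> x3 x2 - x2)"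
    using assms x by (intro logistic_norm_scale) (auto intro: logistic_norm_ge)
  then show ?thesis
    using assms x
    by (simp add: scaleR_prod_def vine_gauge_eq logistic_norm_scale flip: right_diff_distrib)
      (simp add: algebra_simps)
qed

lemma vine_gauge_ge_diagonal:
  assumes "0 < \<alpha>" "0 < \<beta>" "0 < \<gamma>" "1 \<le> x1" "0 \<le> x2" "1 \<le> x3"
  shows "vine_gauge \<alpha> \<beta> \<gamma> (1, x2, 1) \<le> vine_gauge \<alpha> \<beta> \<gamma> (x1, x2, x3)"
  unfolding vine_gauge_eq
  by (intro add_left_mono logistic_norm_mono diff_right_mono)
    (use assms in \<open>auto intro: logistic_norm_ge\<close>)

text \<open>
  This form is the chain rule applied to the outer norm: the weights are its partial derivatives at
  the two excesses, and the brackets are the derivatives of the excesses.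
\<close>

lemma stationarity_lhs_eq:
  assumes "0 < \<alpha>" "0 < \<beta>" "0 < \<gamma>" "0 < v"
  defines "a \<equiv> logistic_norm \<alpha> 1 v - v" and "b \<equiv> logistic_norm \<beta> 1 v - v"
  shows "stationarity_lhs \<alpha> \<beta> \<gamma> v =
    1 + logistic_slope \<gamma> b a * (logistic_slope \<alpha> 1 v - 1)
      + logistic_slope \<gamma> a b * (logistic_slope \<beta> 1 v - 1)"
proof -
  have ab: "0 < a" "0 < b"
    using logistic_norm_gt[of \<alpha> 1 v] logistic_norm_gt[of \<beta> 1 v] assms(1-4) by (auto simp: a_def b_def)
  have s: "(1 + v powr (- 1/\<delta>)) powr (\<delta> - 1) = logistic_slope \<delta> 1 v" for \<delta>
    using assms(4) by (simp add: logistic_slope_def powr_divide powr_minus field_simps)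
  have n: "(1 + v powr (1/\<delta>)) powr \<delta> = logistic_norm \<delta> 1 v" for \<delta>
    by (simp add: logistic_norm_def)
  show ?thesis
    unfolding stationarity_lhs_def s n
    using logistic_slope_eq[of \<gamma> a b] logistic_slope_eq[of \<gamma> b a] ab assms(3)
    by (simp add: a_def b_def algebra_simps)
qed

lemma DERIV_vine_gauge_diagonal:
  assumes "0 < \<alpha>" "0 < \<beta>" "0 < \<gamma>" "0 < v"
  shows "((\<lambda>s. vine_gauge \<alpha> \<beta> \<gamma> (1, s, 1)) has_real_derivative stationarity_lhs \<alpha> \<beta> \<gamma> v) (at v)"
proof -
  have D: "((\<lambda>s. logistic_norm \<delta> 1 s - s) has_real_derivative logistic_slope \<delta> 1 v - 1) (at v)"
    if "0 < \<delta>" for \<delta>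
    using DERIV_diff[OF DERIV_logistic_norm[of \<delta> "\<lambda>_. 1" v "\<lambda>y. y" 0 1] DERIV_ident] assms that by simp
  have "0 < logistic_norm \<delta> 1 v - v" if "0 < \<delta>" for \<delta>
    using logistic_norm_gt[of \<delta> 1 v] assms that by simp
  then have "((\<lambda>s. logistic_norm \<gamma> (logistic_norm \<alpha> 1 s - s) (logistic_norm \<beta> 1 s - s))
      has_real_derivative stationarity_lhs \<alpha> \<beta> \<gamma> v - 1) (at v)"
    using DERIV_logistic_norm[OF assms(3) _ _ D[OF assms(1)] D[OF assms(2)]] assms
    by (simp add: stationarity_lhs_eq)
  from DERIV_add[OF DERIV_ident this] show ?thesis by (simp add: vine_gauge_eq)
qed

text \<open>
  The outer norm lies above its tangent plane, whose coefficients \<open>p\<close> and \<open>q\<close> are positive, and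
  each excess lies strictly above its tangent line. Composed, these bound the gauge at \<open>w\<close> strictly
  from below by the tangent of \<open>s \<mapsto> g (1, s, 1)\<close> at \<open>v\<close>, which is horizontal.
\<close>

lemma vine_gauge_diagonal_strict_min:
  assumes "0 < \<alpha>" "\<alpha> < 1" "0 < \<beta>" "\<beta> < 1" "0 < \<gamma>" "\<gamma> < 1"
    and "0 < v" "stationarity_lhs \<alpha> \<beta> \<gamma> v = 0" "0 \<le> w" "w \<noteq> v"
  shows "vine_gauge \<alpha> \<beta> \<gamma> (1, v, 1) < vine_gauge \<alpha> \<beta> \<gamma> (1, w, 1)"
proof -
  define a b c d where "a = logistic_norm \<alpha> 1 v - v" and "b = logistic_norm \<beta> 1 v - v"
    and "c = logistic_norm \<alpha> 1 w - w" and "d = logistic_norm \<beta> 1 w - w"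
  define p q where "p = logistic_slope \<gamma> b a" and "q = logistic_slope \<gamma> a b"
  have pos: "0 < a" "0 < b" "0 < c" "0 < d" "0 < p" "0 < q"
    using logistic_norm_gt assms
    by (auto simp: a_def b_def c_def d_def p_def q_def logistic_slope_pos)
  have "a + (logistic_slope \<alpha> 1 v - 1) * (w - v) < c" "b + (logistic_slope \<beta> 1 v - 1) * (w - v) < d"
    using logistic_norm_above_tangent[of \<alpha> v w] logistic_norm_above_tangent[of \<beta> v w] assms
    by (auto simp: a_def b_def c_def d_def algebra_simps)
  with pos have "p * (a + (logistic_slope \<alpha> 1 v - 1) * (w - v)) < p * c"
     "q * (b + (logistic_slope \<beta> 1 v - 1) * (w - v)) < q * d"
    by simp_all
  moreover have "p * c + q * d \<le> logistic_norm \<gamma> c d"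
    using logistic_norm_ge_gradient[of \<gamma> a b c d] assms pos by (simp add: p_def q_def)
  moreover have "logistic_norm \<gamma> a b = p * a + q * b"
    using logistic_norm_euler[of \<gamma> a b] assms pos by (simp add: p_def q_def mult.commute)
  moreover have "(1 + p * (logistic_slope \<alpha> 1 v - 1) + q * (logistic_slope \<beta> 1 v - 1)) * (w - v) = 0"
    using assms by (simp add: stationarity_lhs_eq p_def q_def a_def b_def)
  ultimately have "v + logistic_norm \<gamma> a b < w + logistic_norm \<gamma> c d"
    by (simp add: algebra_simps)
  then show ?thesis by (simp add: vine_gauge_eq a_def b_def c_def d_def)
qed

text \<open>
  The intermediate value theorem on \<open>{0..1}\<close>. The left-hand side contains \<open>v powr (- 1 / \<alpha>)\<close> and
  is not continuous at \<open>0\<close> as written, so it is replaced by a function \<open>G\<close> that agrees with it for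
  \<open>v > 0\<close> and extends it continuously to \<open>0\<close>.
\<close>

lemma stationarity_lhs_has_root:
  assumes "0 < \<alpha>" "\<alpha> < 1" "0 < \<beta>" "\<beta> < 1" "0 < \<gamma>" "\<gamma> < 1"
  shows "\<exists>v. 0 < v \<and> v < 1 \<and> stationarity_lhs \<alpha> \<beta> \<gamma> v = 0"
proof -
  define a b where "a = (\<lambda>v. logistic_norm \<alpha> 1 v - v)" and "b = (\<lambda>v. logistic_norm \<beta> 1 v - v)"
  define s where "s = (\<lambda>\<delta> v :: real. (1 + v powr (1/\<delta>)) powr (\<delta> - 1) * v powr (1/\<delta> - 1))"
  define G where "G = (\<lambda>v. 1 + (a v powr (1/\<gamma>) + b v powr (1/\<gamma>)) powr (\<gamma> - 1) *
    (a v powr (1/\<gamma> - 1) * (s \<alpha> v - 1) + b v powr (1/\<gamma> - 1) * (s \<beta> v - 1)))"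
  have ab: "0 < a v" "0 < b v" if "0 \<le> v" for v
    using logistic_norm_gt assms that by (auto simp: a_def b_def)
  have G: "G v = stationarity_lhs \<alpha> \<beta> \<gamma> v" if "0 < v" for v
  proof -
    have "s \<delta> v = logistic_slope \<delta> 1 v" if "0 < \<delta>" for \<delta>
      using \<open>0 < v\<close> that by (simp add: s_def logistic_slope_eq)
    then show ?thesis
      using logistic_slope_eq[of \<gamma> "a v" "b v"] logistic_slope_eq[of \<gamma> "b v" "a v"]
        stationarity_lhs_eq[of \<alpha> \<beta> \<gamma> v] ab[of v] that assms
      unfolding G_def by (simp add: a_def b_def algebra_simps)
  qed
  have conts: "continuous_on {0..1} (s \<delta>)" if "0 < \<delta>" "\<delta> < 1" for \<delta>
    unfolding s_def
    by (intro continuous_on_powr' continuous_intros) (use that in \<open>auto simp: add_nonneg_eq_0_iff\<close>)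
  have contab: "continuous_on {0..1} a" "continuous_on {0..1} b"
    unfolding a_def b_def
    by (intro continuous_on_logistic_norm continuous_intros; use assms in simp)+
  have "continuous_on {0..1} G"
    unfolding G_def
    by (intro continuous_on_powr' continuous_intros contab conts ballI)
      (use assms ab in \<open>auto simp: less_imp_le add_nonneg_eq_0_iff order_less_imp_not_eq2\<close>)
  moreover have "G 0 < 0"
  proof -
    have "s \<delta> 0 = 0" for \<delta> by (simp add: s_def)
    moreover have "a 0 = 1" "b 0 = 1" by (auto simp: a_def b_def logistic_norm_def)
    ultimately have "G 0 = 1 - 2 powr (\<gamma> - 1) * 2" by (simp add: G_def)
    also have "2 powr (\<gamma> - 1) * 2 = 2 powr (\<gamma> - 1 + 1)" unfolding powr_add by simp
    also have "1 < 2 powr (\<gamma> - 1 + 1)" using assms by simp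
    finally show ?thesis by simp
  qed
  moreover have "0 < G 1"
  proof -
    \<comment> \<open>Each summand exceeds \<open>- 1/2\<close>: the inner slopes exceed \<open>1/2\<close> and the weights are below 1.\<close>
    have half: "1/2 < logistic_slope \<delta> 1 1" if "0 < \<delta>" for \<delta> :: real
    proof -
      have "(2::real) powr - 1 < 2 powr (\<delta> - 1)" using that by (intro powr_less_mono) auto
      then show ?thesis by (simp add: logistic_slope_def powr_minus)
    qed
    define p q where "p = logistic_slope \<gamma> (b 1) (a 1)" and "q = logistic_slope \<gamma> (a 1) (b 1)"
    have pq: "0 < p" "p < 1" "0 < q" "q < 1"
      using ab[of 1] assms by (auto simp: p_def q_def logistic_slope_pos logistic_slope_less_1)
    have "p * (- (1/2)) < p * (logistic_slope \<alpha> 1 1 - 1)" "q * (- (1/2)) < q * (logistic_slope \<beta> 1 1 - 1)"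
      by (rule mult_strict_left_mono; use pq half[OF assms(1)] half[OF assms(3)] in linarith)+
    moreover have "G 1 = 1 + p * (logistic_slope \<alpha> 1 1 - 1) + q * (logistic_slope \<beta> 1 1 - 1)"
      using G[of 1] assms by (simp add: stationarity_lhs_eq p_def q_def a_def b_def)
    ultimately show ?thesis using pq by simp
  qed
  ultimately obtain v where v: "0 \<le> v" "v \<le> 1" "G v = 0"
    using IVT'[of G 0 0 1] by auto
  with \<open>G 0 < 0\<close> \<open>0 < G 1\<close> have "v \<noteq> 0" "v \<noteq> 1" by auto
  with v have "0 < v" "v < 1" by linarith+
  with v G[of v] show ?thesis by auto
qed

lemma stationarity_lhs_unique_root:
  assumes "0 < \<alpha>" "\<alpha> < 1" "0 < \<beta>" "\<beta> < 1" "0 < \<gamma>" "\<gamma> < 1"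
    and "0 < v" "stationarity_lhs \<alpha> \<beta> \<gamma> v = 0" "0 < w" "stationarity_lhs \<alpha> \<beta> \<gamma> w = 0"
  shows "v = w"
  using vine_gauge_diagonal_strict_min[of \<alpha> \<beta> \<gamma> v w] vine_gauge_diagonal_strict_min[of \<alpha> \<beta> \<gamma> w v] assms
  by fastforce

lemma vine_gauge_minimum:
  assumes "0 < \<alpha>" "\<alpha> < 1" "0 < \<beta>" "\<beta> < 1" "0 < \<gamma>" "\<gamma> < 1"
    and "0 < v" "stationarity_lhs \<alpha> \<beta> \<gamma> v = 0" "x \<in> tail_region_13"
  shows "vine_gauge \<alpha> \<beta> \<gamma> (1, v, 1) \<le> vine_gauge \<alpha> \<beta> \<gamma> x"
proof -
  obtain x1 x2 x3 where x: "x = (x1, x2, x3)" "1 \<le> x1" "0 \<le> x2" "1 \<le> x3"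
    using assms(9) by (auto simp: tail_region_13_def)
  have "vine_gauge \<alpha> \<beta> \<gamma> (1, v, 1) \<le> vine_gauge \<alpha> \<beta> \<gamma> (1, x2, 1)"
    using vine_gauge_diagonal_strict_min[of \<alpha> \<beta> \<gamma> v x2] assms x by (cases "x2 = v") auto
  also have "\<dots> \<le> vine_gauge \<alpha> \<beta> \<gamma> x"
    using vine_gauge_ge_diagonal assms x by simp
  finally show ?thesis .
qed

lemma eta_13_vine_gauge:
  assumes "0 < \<alpha>" "\<alpha> < 1" "0 < \<beta>" "\<beta> < 1" "0 < \<gamma>" "\<gamma> < 1"
    and "0 < v" "stationarity_lhs \<alpha> \<beta> \<gamma> v = 0"
  shows "eta_13 (vine_gauge \<alpha> \<beta> \<gamma>) = inverse (vine_gauge \<alpha> \<beta> \<gamma> (1, v, 1))"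
proof -
  have "(LEAST m. m \<in> vine_gauge \<alpha> \<beta> \<gamma> ` tail_region_13) = vine_gauge \<alpha> \<beta> \<gamma> (1, v, 1)"
    using assms vine_gauge_minimum[OF assms]
    by (intro Least_equality) (auto simp: tail_region_13_def)
  then show ?thesis by (simp add: eta_13_def)
qed

text \<open>
  With equal excesses the outer slopes are both \<open>2 powr (\<gamma> - 1)\<close>, so stationarity fixes the value
  of the inner slope, \<open>1 - 2 powr (- \<gamma>)\<close>, which is then inverted for \<open>v\<close>.
\<close>

lemma stationary_point_symmetric:
  assumes "0 < \<alpha>" "\<alpha> < 1" "0 < \<gamma>" "0 < v" "stationarity_lhs \<alpha> \<alpha> \<gamma> v = 0"
  shows "1 + v powr (- 1 / \<alpha>) = (1 - 2 powr (- \<gamma>)) powr (- 1 / (1 - \<alpha>))"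
proof -
  define s where "s = logistic_slope \<alpha> 1 v"
  have s0: "0 < s" by (simp add: s_def logistic_slope_pos)
  have "logistic_slope \<gamma> a a = 2 powr (\<gamma> - 1)" if "0 < a" for a
    using that by (simp add: logistic_slope_def)
  moreover have "0 < logistic_norm \<alpha> 1 v - v" using logistic_norm_gt[of \<alpha> 1 v] assms by simp
  ultimately have "1 + 2 powr (\<gamma> - 1) * 2 * (s - 1) = 0"
    using assms by (simp add: stationarity_lhs_eq s_def algebra_simps)
  moreover have "2 powr (\<gamma> - 1) * 2 = (2::real) powr \<gamma>" by (simp add: powr_diff)
  ultimately have "2 powr \<gamma> * (1 - s) = 1" by (simp add: algebra_simps)
  then have "1 - s = 2 powr (- \<gamma>)" by (simp add: powr_minus field_simps)
  then have s: "s = 1 - 2 powr (- \<gamma>)" by simp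
  have "s powr (- 1 / (1 - \<alpha>)) = (1 + v powr (- 1 / \<alpha>)) powr ((\<alpha> - 1) * (- 1 / (1 - \<alpha>)))"
    using assms by (simp add: s_def logistic_slope_def powr_powr powr_divide powr_minus field_simps)
  also have "(\<alpha> - 1) * (- 1 / (1 - \<alpha>)) = 1" using assms by (simp add: field_simps)
  also have "(1 + v powr (- 1 / \<alpha>)) powr 1 = 1 + v powr (- 1 / \<alpha>)"
    by (intro powr_one) (simp add: add_nonneg_nonneg)
  finally show ?thesis by (simp add: s)
qed

lemma symmetric_closed_form:
  fixes v \<alpha> \<gamma> :: real
  assumes "0 < \<alpha>" "\<alpha> < 1" "0 < \<gamma>" "0 < v" "stationarity_lhs \<alpha> \<alpha> \<gamma> v = 0"
  defines "D \<equiv> (1 - 2 powr (- \<gamma>)) powr (- 1 / (1 - \<alpha>))"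
  shows "v = (D - 1) powr (- \<alpha>)"
    and "inverse (vine_gauge \<alpha> \<alpha> \<gamma> (1, v, 1)) =
      (D - 1) powr \<alpha> / (1 - 2 powr \<gamma> + 2 powr \<gamma> * (1 - 2 powr (- \<gamma>)) powr (- \<alpha> / (1 - \<alpha>)))"
proof -
  have D: "D - 1 = v powr (- 1 / \<alpha>)"
    using stationary_point_symmetric[OF assms(1-5)] by (simp add: D_def)
  show v: "v = (D - 1) powr (- \<alpha>)" using assms(1,4) by (simp add: D powr_powr)
  have D\<alpha>: "D powr \<alpha> = (1 - 2 powr (- \<gamma>)) powr (- \<alpha> / (1 - \<alpha>))"
    by (simp add: D_def powr_powr)
  define c where "c = logistic_norm \<alpha> 1 v - v"
  have c: "0 < c" using logistic_norm_gt[of \<alpha> 1 v] assms(1,4) by (simp add: c_def)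
  have "logistic_norm \<alpha> 1 v = v * logistic_norm \<alpha> (1 / v) 1"
    using logistic_norm_scale[of \<alpha> v "1/v" 1] assms(1,4) by simp
  also have "logistic_norm \<alpha> (1 / v) 1 = (v powr (- 1 / \<alpha>) + 1) powr \<alpha>"
    using assms(4) by (simp add: logistic_norm_def powr_divide powr_minus field_simps)
  also have "v powr (- 1 / \<alpha>) + 1 = D" using D by simp
  finally have N: "c = v * (D powr \<alpha> - 1)" by (simp add: c_def algebra_simps)
  have "logistic_norm \<gamma> c c = c * logistic_norm \<gamma> 1 1"
    using logistic_norm_scale[of \<gamma> c 1 1] c assms(3) by simp
  then have "vine_gauge \<alpha> \<alpha> \<gamma> (1, v, 1) = v + c * 2 powr \<gamma>"
    by (simp add: vine_gauge_eq c_def logistic_norm_def)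
  also have "\<dots> = v * (1 - 2 powr \<gamma> + 2 powr \<gamma> * D powr \<alpha>)"
    by (simp add: N algebra_simps)
  finally have "inverse (vine_gauge \<alpha> \<alpha> \<gamma> (1, v, 1)) =
      inverse v / (1 - 2 powr \<gamma> + 2 powr \<gamma> * D powr \<alpha>)"
    by (simp add: field_simps)
  moreover have "inverse v = (D - 1) powr \<alpha>" by (subst v) (simp add: powr_minus)
  ultimately show "inverse (vine_gauge \<alpha> \<alpha> \<gamma> (1, v, 1)) =
      (D - 1) powr \<alpha> / (1 - 2 powr \<gamma> + 2 powr \<gamma> * (1 - 2 powr (- \<gamma>)) powr (- \<alpha> / (1 - \<alpha>)))"
    by (simp add: D\<alpha>)
qed

section \<open>The joint density in exponential margins\<close>

text \<open>
  The mixed second derivative of \<open>exp (- N)\<close> divided by \<open>exp (- N)\<close>, for the logistic norm \<open>N\<close>: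
  the subexponential factor of the pair density.
\<close>

definition logistic_kernel :: "real \<Rightarrow> real \<Rightarrow> real \<Rightarrow> real" where
  "logistic_kernel \<alpha> a b = logistic_slope \<alpha> b a * logistic_slope \<alpha> a b + logistic_bend \<alpha> a b"

text \<open>
  The exponential coordinate of the conditional distribution function of the first component given
  the second: \<open>-ln\<close> of the conditional survival probability.
\<close>

definition conditional_excess :: "real \<Rightarrow> real \<Rightarrow> real \<Rightarrow> real" where
  "conditional_excess \<alpha> x y = logistic_norm \<alpha> x y - y - ln (logistic_slope \<alpha> x y)"

lemma logistic_kernel_pos:
  assumes "0 < \<alpha>" "\<alpha> < 1" "0 < b"
  shows "0 < logistic_kernel \<alpha> a b"
  using assms by (simp add: logistic_kernel_def logistic_slope_pos logistic_bend_nonneg add_pos_nonneg)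

lemma conditional_excess_pos:
  assumes "0 < \<alpha>" "\<alpha> < 1" "0 < x" "0 < y"
  shows "0 < conditional_excess \<alpha> x y"
proof -
  have "ln (logistic_slope \<alpha> x y) < 0"
    using assms by (simp add: logistic_slope_pos logistic_slope_less_1)
  then show ?thesis
    using logistic_norm_gt[of \<alpha> x y] assms by (simp add: conditional_excess_def)
qed

lemma inverted_logistic_copula_eq:
  assumes "s < 1" "0 < s" "t < 1" "0 < t"
  shows "inverted_logistic_copula \<alpha> s t =
    s + t - 1 + exp (- logistic_norm \<alpha> (- ln (1 - s)) (- ln (1 - t)))"
proof -
  have "(- 1 / ln (1 - u)) powr (- 1 / \<alpha>) = (- ln (1 - u)) powr (1 / \<alpha>)" if "0 < u" "u < 1" for u
  proof -
    have "ln (1 - u) < 0" using that by simp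
    then have e: "- 1 / ln (1 - u) = inverse (- ln (1 - u))" by (simp add: field_simps)
    have m: "- 1 / \<alpha> = - (1 / \<alpha>)" by simp
    show ?thesis
      unfolding e m powr_minus
      using \<open>ln (1 - u) < 0\<close> by (simp add: inverse_powr del: inverse_minus_eq)
  qed
  then show ?thesis
    using assms
    by (simp add: inverted_logistic_copula_def inverted_ev_copula_def logistic_exponent_measure_def
        logistic_norm_def)
qed

lemma inverted_logistic_copula_commute:
  "inverted_logistic_copula \<alpha> s t = inverted_logistic_copula \<alpha> t s"
  by (simp add: inverted_logistic_copula_def inverted_ev_copula_def logistic_exponent_measure_def
      add.commute)

lemma deriv_inverted_logistic_copula:
  assumes "0 < \<alpha>" "0 < s" "s < 1" "0 < t" "t < 1"
  shows "deriv (\<lambda>y. inverted_logistic_copula \<alpha> s y) t =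
    1 - exp (- logistic_norm \<alpha> (- ln (1 - s)) (- ln (1 - t)))
      * logistic_slope \<alpha> (- ln (1 - s)) (- ln (1 - t)) / (1 - t)"
proof -
  have pos: "0 < - ln (1 - s)" "0 < - ln (1 - t)" using assms by simp_all
  have "((\<lambda>y. - ln (1 - y)) has_real_derivative 1 / (1 - t)) (at t)"
    using assms by (auto intro!: derivative_eq_intros)
  from DERIV_logistic_norm[OF assms(1) _ _ DERIV_const this, of "- ln (1 - s)"] pos
  have D: "((\<lambda>y. logistic_norm \<alpha> (- ln (1 - s)) (- ln (1 - y))) has_real_derivative
      logistic_slope \<alpha> (- ln (1 - s)) (- ln (1 - t)) / (1 - t)) (at t)" by simp
  have "((\<lambda>y. s + y - 1 + exp (- logistic_norm \<alpha> (- ln (1 - s)) (- ln (1 - y)))) has_real_derivative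
      1 - exp (- logistic_norm \<alpha> (- ln (1 - s)) (- ln (1 - t)))
      * logistic_slope \<alpha> (- ln (1 - s)) (- ln (1 - t)) / (1 - t)) (at t)"
    by (rule derivative_eq_intros D refl)+ simp
  then have "((\<lambda>y. inverted_logistic_copula \<alpha> s y) has_real_derivative
      1 - exp (- logistic_norm \<alpha> (- ln (1 - s)) (- ln (1 - t)))
      * logistic_slope \<alpha> (- ln (1 - s)) (- ln (1 - t)) / (1 - t)) (at t)"
    by (rule has_field_derivative_transform_within_open[where S = "{0<..<1}"])
      (use assms in \<open>auto simp: inverted_logistic_copula_eq\<close>)
  then show ?thesis by (rule DERIV_imp_deriv)
qed

lemma copula_density_inverted_logistic:
  assumes "0 < \<alpha>" "0 < u" "u < 1" "0 < v" "v < 1"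
  shows "copula_density (inverted_logistic_copula \<alpha>) u v =
    exp (- logistic_norm \<alpha> (- ln (1 - u)) (- ln (1 - v)))
      * logistic_kernel \<alpha> (- ln (1 - u)) (- ln (1 - v)) / ((1 - u) * (1 - v))"
proof -
  define a b where "a = - ln (1 - u)" and "b = - ln (1 - v)"
  have pos: "0 < a" "0 < b" using assms by (simp_all add: a_def b_def)
  have E: "((\<lambda>s. - ln (1 - s)) has_real_derivative 1 / (1 - u)) (at u)"
    using assms by (auto intro!: derivative_eq_intros)
  from DERIV_logistic_norm[OF assms(1) _ _ E DERIV_const, of b] pos
  have DN: "((\<lambda>s. logistic_norm \<alpha> (- ln (1 - s)) b) has_real_derivative
      logistic_slope \<alpha> b a * (1 / (1 - u))) (at u)" by (simp add: a_def)
  have DS: "((\<lambda>s. logistic_slope \<alpha> (- ln (1 - s)) b) has_real_derivative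
      - logistic_bend \<alpha> a b * (1 / (1 - u))) (at u)"
    using DERIV_chain2[OF DERIV_logistic_slope E, of \<alpha> b] assms pos by (simp add: a_def)
  have "((\<lambda>s. exp (- logistic_norm \<alpha> (- ln (1 - s)) b) * logistic_slope \<alpha> (- ln (1 - s)) b)
      has_real_derivative - (exp (- logistic_norm \<alpha> a b) * logistic_kernel \<alpha> a b / (1 - u))) (at u)"
    by (rule derivative_eq_intros DN DS refl)+
      (use assms in \<open>simp add: logistic_kernel_def divide_inverse algebra_simps flip: a_def\<close>)
  from DERIV_diff[OF DERIV_const[of 1] DERIV_cdivide[OF this, of "1 - v"]]
  have "((\<lambda>s. 1 - exp (- logistic_norm \<alpha> (- ln (1 - s)) b) * logistic_slope \<alpha> (- ln (1 - s)) b / (1 - v))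
      has_real_derivative exp (- logistic_norm \<alpha> a b) * logistic_kernel \<alpha> a b / ((1 - u) * (1 - v))) (at u)"
    by simp
  then have "((\<lambda>s. deriv (\<lambda>t. inverted_logistic_copula \<alpha> s t) v) has_real_derivative
      exp (- logistic_norm \<alpha> a b) * logistic_kernel \<alpha> a b / ((1 - u) * (1 - v))) (at u)"
    by (rule has_field_derivative_transform_within_open[where S = "{0<..<1}"])
      (use assms in \<open>auto simp: deriv_inverted_logistic_copula b_def\<close>)
  then show ?thesis
    unfolding copula_density_def a_def b_def by (rule DERIV_imp_deriv)
qed

lemma copula_density_inverted_logistic_exp:
  assumes "0 < \<alpha>" "0 < x" "0 < y"
  shows "copula_density (inverted_logistic_copula \<alpha>) (1 - exp (- x)) (1 - exp (- y)) =
    exp (x + y - logistic_norm \<alpha> x y) * logistic_kernel \<alpha> x y"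
proof -
  have "copula_density (inverted_logistic_copula \<alpha>) (1 - exp (- x)) (1 - exp (- y)) =
      exp (- logistic_norm \<alpha> x y) * logistic_kernel \<alpha> x y / (exp (- x) * exp (- y))"
    using assms by (simp add: copula_density_inverted_logistic)
  then show ?thesis by (simp add: exp_add exp_diff exp_minus field_simps)
qed

lemma conditional_inverted_logistic:
  assumes "0 < \<alpha>" "\<alpha> < 1" "0 < x" "0 < y"
  shows "deriv (\<lambda>s. inverted_logistic_copula \<alpha> (1 - exp (- x)) s) (1 - exp (- y)) =
    1 - exp (- conditional_excess \<alpha> x y)"
proof -
  have "exp (- conditional_excess \<alpha> x y) = exp (- logistic_norm \<alpha> x y) * logistic_slope \<alpha> x y / exp (- y)"
    using logistic_slope_pos[of \<alpha> x y]
    by (simp add: conditional_excess_def exp_add exp_diff exp_minus field_simps)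
  then show ?thesis
    using assms by (simp add: deriv_inverted_logistic_copula)
qed

text \<open>
  The third pair density contributes \<open>exp (a + b)\<close>, which cancels the norms in the exponents of the
  other two and leaves the reciprocals of the slopes.
\<close>

lemma exponential_margins_density_vine:
  assumes "0 < \<alpha>" "\<alpha> < 1" "0 < \<beta>" "\<beta> < 1" "0 < \<gamma>" "\<gamma> < 1" "0 < x1" "0 < x2" "0 < x3"
  defines "a \<equiv> conditional_excess \<alpha> x1 x2" and "b \<equiv> conditional_excess \<beta> x3 x2"
  shows "exponential_margins_density
      (vine_copula_density (inverted_logistic_copula \<alpha>) (inverted_logistic_copula \<beta>)
        (inverted_logistic_copula \<gamma>)) (x1, x2, x3) =
    exp (- (x2 + logistic_norm \<gamma> a b)) *
    (logistic_kernel \<alpha> x1 x2 * logistic_kernel \<beta> x2 x3 * logistic_kernel \<gamma> a b /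
      (logistic_slope \<alpha> x1 x2 * logistic_slope \<beta> x3 x2))"
proof -
  have ab: "0 < a" "0 < b" using assms(1-9) by (auto simp: a_def b_def conditional_excess_pos)
  have c: "deriv (\<lambda>s. inverted_logistic_copula \<beta> s (1 - exp (- x3))) (1 - exp (- x2)) = 1 - exp (- b)"
    using conditional_inverted_logistic[of \<beta> x3 x2] assms(1-9)
    by (simp add: b_def inverted_logistic_copula_commute[of \<beta> _ "1 - exp (- x3)"])
  have ea: "exp a = exp (logistic_norm \<alpha> x1 x2 - x2) / logistic_slope \<alpha> x1 x2"
    and eb: "exp b = exp (logistic_norm \<beta> x2 x3 - x2) / logistic_slope \<beta> x3 x2"
    using logistic_slope_pos[of \<alpha> x1 x2] logistic_slope_pos[of \<beta> x3 x2]
    by (simp_all add: a_def b_def conditional_excess_def exp_diff logistic_norm_commute[of \<beta> x2 x3])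
  have "exponential_margins_density
      (vine_copula_density (inverted_logistic_copula \<alpha>) (inverted_logistic_copula \<beta>)
        (inverted_logistic_copula \<gamma>)) (x1, x2, x3) =
    (exp (x1 + x2 - logistic_norm \<alpha> x1 x2) * logistic_kernel \<alpha> x1 x2) *
    (exp (x2 + x3 - logistic_norm \<beta> x2 x3) * logistic_kernel \<beta> x2 x3) *
    (exp (a + b - logistic_norm \<gamma> a b) * logistic_kernel \<gamma> a b) *
    exp (- x1) * exp (- x2) * exp (- x3)"
    using assms(1-9) ab
    by (simp add: exponential_margins_density_def vine_copula_density_def c
        conditional_inverted_logistic copula_density_inverted_logistic_exp flip: a_def)
  also have "\<dots> = exp (- (x2 + logistic_norm \<gamma> a b)) *
    (logistic_kernel \<alpha> x1 x2 * logistic_kernel \<beta> x2 x3 * logistic_kernel \<gamma> a b /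
      (logistic_slope \<alpha> x1 x2 * logistic_slope \<beta> x3 x2))"
    unfolding exp_add[of a b] exp_diff[of "a + b"] ea eb
    using logistic_slope_pos[of \<alpha> x1 x2] logistic_slope_pos[of \<beta> x3 x2]
    by (simp add: exp_add exp_diff exp_minus field_simps)
  finally show ?thesis .
qed

section \<open>Asymptotics along rays\<close>

lemma tendsto_logistic_norm:
  assumes "(f \<longlongrightarrow> a) F" "(g \<longlongrightarrow> b) F" "0 < a" "0 < b"
  shows "((\<lambda>x. logistic_norm \<alpha> (f x) (g x)) \<longlongrightarrow> logistic_norm \<alpha> a b) F"
proof -
  have "a powr (1/\<alpha>) + b powr (1/\<alpha>) \<noteq> 0"
    using assms by (metis add_pos_nonneg less_irrefl powr_ge_zero powr_gt_zero)
  then show ?thesis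
    unfolding logistic_norm_def by (intro tendsto_intros) (use assms in auto)
qed

lemma tendsto_logistic_slope:
  assumes "(f \<longlongrightarrow> a) F" "(g \<longlongrightarrow> b) F" "0 < a" "0 < b"
  shows "((\<lambda>x. logistic_slope \<alpha> (f x) (g x)) \<longlongrightarrow> logistic_slope \<alpha> a b) F"
proof -
  have "1 + (a / b) powr (1/\<alpha>) \<noteq> 0"
    by (metis add_pos_nonneg less_irrefl powr_ge_zero zero_less_one)
  then show ?thesis
    unfolding logistic_slope_def by (intro tendsto_intros) (use assms in auto)
qed

lemma tendsto_logistic_bend:
  assumes "(f \<longlongrightarrow> a) F" "(g \<longlongrightarrow> b) F" "0 < a" "0 < b"
  shows "((\<lambda>x. logistic_bend \<alpha> (f x) (g x)) \<longlongrightarrow> logistic_bend \<alpha> a b) F"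
proof -
  have "1 + (a / b) powr (1/\<alpha>) \<noteq> 0"
    by (metis add_pos_nonneg less_irrefl powr_ge_zero zero_less_one)
  then show ?thesis
    unfolding logistic_bend_def divide_inverse[of _ \<alpha>]
    by (intro tendsto_intros) (use assms in auto)
qed

lemma conditional_excess_scale:
  assumes "0 < \<alpha>" "0 < t" "0 < x" "0 < y"
  shows "conditional_excess \<alpha> (t * x) (t * y) =
    t * (logistic_norm \<alpha> x y - y - ln (logistic_slope \<alpha> x y) / t)"
  using assms by (simp add: conditional_excess_def logistic_norm_scale logistic_slope_scale right_diff_distrib)

text \<open>
  The product of slopes is invariant under scaling, and the second-order term decays like \<open>1/t\<close>.
\<close>

lemma tendsto_logistic_kernel_scaled:
  assumes "(f \<longlongrightarrow> a) at_top" "(g \<longlongrightarrow> b) at_top" "0 < a" "0 < b"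
  shows "((\<lambda>t. logistic_kernel \<alpha> (t * f t) (t * g t)) \<longlongrightarrow>
    logistic_slope \<alpha> b a * logistic_slope \<alpha> a b) at_top"
proof -
  have "((\<lambda>t. logistic_slope \<alpha> (g t) (f t) * logistic_slope \<alpha> (f t) (g t) + logistic_bend \<alpha> (f t) (g t) / t)
      \<longlongrightarrow> logistic_slope \<alpha> b a * logistic_slope \<alpha> a b + 0) at_top"
    by (intro tendsto_add tendsto_mult tendsto_logistic_slope
        tendsto_divide_0[OF tendsto_logistic_bend[OF assms]] filterlim_at_top_imp_at_infinity filterlim_ident assms)
  moreover have "eventually (\<lambda>t. logistic_slope \<alpha> (g t) (f t) * logistic_slope \<alpha> (f t) (g t)
      + logistic_bend \<alpha> (f t) (g t) / t = logistic_kernel \<alpha> (t * f t) (t * g t)) at_top"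
    using eventually_gt_at_top[of 0]
    by eventually_elim (simp add: logistic_kernel_def logistic_slope_scale logistic_bend_scale)
  ultimately show ?thesis by (simp add: filterlim_cong)
qed

text \<open>
  With \<open>a\<close> and \<open>b\<close> the conditional excesses divided by \<open>t\<close>, the quotient of \<open>- ln\<close> of the density by
  \<open>t\<close> is exactly \<open>x2 + N \<gamma> (a t) (b t) - ln (Q t) / t\<close>, where \<open>Q\<close> collects the subexponential factors
  and has a positive limit.
\<close>

lemma neg_ln_vine_density_asymp:
  assumes "0 < \<alpha>" "\<alpha> < 1" "0 < \<beta>" "\<beta> < 1" "0 < \<gamma>" "\<gamma> < 1" "0 < x1" "0 < x2" "0 < x3"
  defines "f \<equiv> exponential_margins_density
      (vine_copula_density (inverted_logistic_copula \<alpha>) (inverted_logistic_copula \<beta>)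
        (inverted_logistic_copula \<gamma>))"
  shows "(\<lambda>t. - ln (f (t *\<^sub>R (x1, x2, x3)))) \<sim>[at_top] (\<lambda>t. t * vine_gauge \<alpha> \<beta> \<gamma> (x1, x2, x3))"
proof -
  define A B where "A = logistic_norm \<alpha> x1 x2 - x2" and "B = logistic_norm \<beta> x3 x2 - x2"
  define c d where "c = logistic_slope \<alpha> x1 x2" and "d = logistic_slope \<beta> x3 x2"
  define a b where "a = (\<lambda>t. A - ln c / t)" and "b = (\<lambda>t. B - ln d / t)"
  define Q where "Q = (\<lambda>t. logistic_kernel \<alpha> (t * x1) (t * x2) * logistic_kernel \<beta> (t * x2) (t * x3) *
    logistic_kernel \<gamma> (t * a t) (t * b t) / (c * d))"
  define g where "g = vine_gauge \<alpha> \<beta> \<gamma> (x1, x2, x3)"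
  have AB: "0 < A" "0 < B" using logistic_norm_gt assms(1-9) by (auto simp: A_def B_def)
  have cd: "0 < c" "0 < d" by (auto simp: c_def d_def logistic_slope_pos)
  have g: "0 < g" using vine_gauge_pos assms(1-9) by (simp add: g_def)
  have g_eq: "g = x2 + logistic_norm \<gamma> A B" by (simp add: g_def vine_gauge_eq A_def B_def)
  have lim0: "((\<lambda>t. k / t) \<longlongrightarrow> 0) at_top" for k :: real
    by (intro tendsto_divide_0[OF tendsto_const] filterlim_at_top_imp_at_infinity filterlim_ident)
  have lima: "(a \<longlongrightarrow> A) at_top" and limb: "(b \<longlongrightarrow> B) at_top"
    unfolding a_def b_def using tendsto_diff[OF tendsto_const lim0] by fastforce+
  have "\<exists>q>0. (Q \<longlongrightarrow> q) at_top"
  proof (intro exI conjI)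
    show "(Q \<longlongrightarrow> (logistic_slope \<alpha> x2 x1 * logistic_slope \<alpha> x1 x2) *
        (logistic_slope \<beta> x3 x2 * logistic_slope \<beta> x2 x3) *
        (logistic_slope \<gamma> B A * logistic_slope \<gamma> A B) / (c * d)) at_top"
      unfolding Q_def
      by (intro tendsto_divide tendsto_mult tendsto_logistic_kernel_scaled tendsto_const lima limb)
        (use assms(1-9) AB cd in auto)
  qed (use cd in \<open>auto simp: logistic_slope_pos\<close>)
  then obtain q where q: "0 < q" "(Q \<longlongrightarrow> q) at_top" by blast
  have limlnQ: "((\<lambda>t. ln (Q t) / t) \<longlongrightarrow> 0) at_top"
    by (intro tendsto_divide_0[OF tendsto_ln[OF q(2)]] filterlim_at_top_imp_at_infinity filterlim_ident)
      (use q in auto)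
  have ev: "(x2 + logistic_norm \<gamma> (a t) (b t) - ln (Q t) / t) / g =
      - ln (f (t *\<^sub>R (x1, x2, x3))) / (t * g)" if t: "0 < t" for t
  proof -
    have ca: "conditional_excess \<alpha> (t * x1) (t * x2) = t * a t"
      and cb: "conditional_excess \<beta> (t * x3) (t * x2) = t * b t"
      using assms(1-9) t by (auto simp: conditional_excess_scale a_def b_def A_def B_def c_def d_def)
    have pos: "0 < t * a t" "0 < t * b t"
      using conditional_excess_pos[of \<alpha> "t * x1" "t * x2"] conditional_excess_pos[of \<beta> "t * x3" "t * x2"]
        assms(1-9) t unfolding ca cb by simp_all
    then have pos': "0 < a t" "0 < b t" using t by (auto simp: zero_less_mult_iff)
    have "0 < Q t"
      unfolding Q_def using assms(1-9) t pos cd by (auto intro!: divide_pos_pos mult_pos_pos logistic_kernel_pos)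
    moreover have "f (t *\<^sub>R (x1, x2, x3)) = exp (- (t * x2 + logistic_norm \<gamma> (t * a t) (t * b t))) * Q t"
      using exponential_margins_density_vine[of \<alpha> \<beta> \<gamma> "t * x1" "t * x2" "t * x3"] assms(1-9) t
      by (simp add: f_def scaleR_prod_def Q_def ca cb c_def d_def logistic_slope_scale)
    moreover have "logistic_norm \<gamma> (t * a t) (t * b t) = t * logistic_norm \<gamma> (a t) (b t)"
      using logistic_norm_scale pos' assms(5) t by simp
    ultimately have "- ln (f (t *\<^sub>R (x1, x2, x3))) = t * (x2 + logistic_norm \<gamma> (a t) (b t) - ln (Q t) / t)"
      using t by (simp add: ln_mult algebra_simps)
    then show ?thesis using t by simp
  qed
  have "((\<lambda>t. (x2 + logistic_norm \<gamma> (a t) (b t) - ln (Q t) / t) / g) \<longlongrightarrow>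
      (x2 + logistic_norm \<gamma> A B - 0) / g) at_top"
    by (intro tendsto_intros tendsto_logistic_norm lima limb limlnQ) (use AB g in auto)
  then have "((\<lambda>t. (x2 + logistic_norm \<gamma> (a t) (b t) - ln (Q t) / t) / g) \<longlongrightarrow> 1) at_top"
    using g by (simp add: g_eq)
  then have "((\<lambda>t. - ln (f (t *\<^sub>R (x1, x2, x3))) / (t * g)) \<longlongrightarrow> 1) at_top"
    by (rule Lim_transform_eventually) (rule eventually_mono[OF eventually_gt_at_top[of 0] ev])
  then show ?thesis unfolding g_def by (rule asymp_equivI')
qed

lemma is_gauge_function_vine:
  assumes "0 < \<alpha>" "\<alpha> < 1" "0 < \<beta>" "\<beta> < 1" "0 < \<gamma>" "\<gamma> < 1"
  shows "is_gauge_function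
      (exponential_margins_density
        (vine_copula_density (inverted_logistic_copula \<alpha>) (inverted_logistic_copula \<beta>)
          (inverted_logistic_copula \<gamma>)))
      (vine_gauge \<alpha> \<beta> \<gamma>)"
  unfolding is_gauge_function_def
  using continuous_on_vine_gauge[of \<alpha> \<beta> \<gamma>] vine_gauge_scale[of \<alpha> \<beta> \<gamma>]
    neg_ln_vine_density_asymp[of \<alpha> \<beta> \<gamma>] assms
  by auto

theorem mainTheorem4:
  fixes \<alpha> \<beta> \<gamma> :: real
  assumes "0 < \<alpha>" "\<alpha> < 1" "0 < \<beta>" "\<beta> < 1" "0 < \<gamma>" "\<gamma> < 1"
  shows
   "is_gauge_function
      (exponential_margins_density
        (vine_copula_density (inverted_logistic_copula \<alpha>) (inverted_logistic_copula \<beta>)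
          (inverted_logistic_copula \<gamma>)))
      (vine_gauge \<alpha> \<beta> \<gamma>) \<and>
    (\<exists>x. is_arg_min (vine_gauge \<alpha> \<beta> \<gamma>) (\<lambda>y. y \<in> tail_region_13) x) \<and>
    (\<forall>v > 0. ((\<lambda>s. vine_gauge \<alpha> \<beta> \<gamma> (1, s, 1)) has_real_derivative stationarity_lhs \<alpha> \<beta> \<gamma> v) (at v)) \<and>
    (\<exists>!v. v > 0 \<and> stationarity_lhs \<alpha> \<beta> \<gamma> v = 0) \<and>
    (\<forall>v > 0. stationarity_lhs \<alpha> \<beta> \<gamma> v = 0 \<longrightarrow>
       v < 1 \<and>
       eta_13 (vine_gauge \<alpha> \<beta> \<gamma>) =
         inverse (v + (((1 + v powr (1/\<alpha>)) powr \<alpha> - v) powr (1/\<gamma>)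
                     + ((1 + v powr (1/\<beta>)) powr \<beta> - v) powr (1/\<gamma>)) powr \<gamma>) \<and>
       (\<alpha> = \<beta> \<longrightarrow>
          v = ((1 - 2 powr (- \<gamma>)) powr (- 1 / (1 - \<alpha>)) - 1) powr (- \<alpha>) \<and>
          eta_13 (vine_gauge \<alpha> \<beta> \<gamma>) =
            ((1 - 2 powr (- \<gamma>)) powr (- 1 / (1 - \<alpha>)) - 1) powr \<alpha>
            / (1 - 2 powr \<gamma> + 2 powr \<gamma> * (1 - 2 powr (- \<gamma>)) powr (- \<alpha> / (1 - \<alpha>)))))"
proof (intro conjI allI impI)
  obtain v where v: "0 < v" "v < 1" "stationarity_lhs \<alpha> \<beta> \<gamma> v = 0"
    using stationarity_lhs_has_root[OF assms] by blast
  show "is_gauge_function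
      (exponential_margins_density
        (vine_copula_density (inverted_logistic_copula \<alpha>) (inverted_logistic_copula \<beta>)
          (inverted_logistic_copula \<gamma>)))
      (vine_gauge \<alpha> \<beta> \<gamma>)"
    by (rule is_gauge_function_vine[OF assms])
  show "\<exists>x. is_arg_min (vine_gauge \<alpha> \<beta> \<gamma>) (\<lambda>y. y \<in> tail_region_13) x"
    using vine_gauge_minimum[OF assms v(1,3)] v
    by (intro exI[of _ "(1, v, 1)"]) (auto simp: is_arg_min_linorder tail_region_13_def)
  show "((\<lambda>s. vine_gauge \<alpha> \<beta> \<gamma> (1, s, 1)) has_real_derivative stationarity_lhs \<alpha> \<beta> \<gamma> w) (at w)"
    if "0 < w" for w
    using DERIV_vine_gauge_diagonal assms that by simp
  show "\<exists>!v. v > 0 \<and> stationarity_lhs \<alpha> \<beta> \<gamma> v = 0"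
    using v stationarity_lhs_unique_root[OF assms] by blast
next
  fix w assume w: "0 < w" "stationarity_lhs \<alpha> \<beta> \<gamma> w = 0"
  show "w < 1"
    using stationarity_lhs_has_root[OF assms] stationarity_lhs_unique_root[OF assms w] by blast
  show eta: "eta_13 (vine_gauge \<alpha> \<beta> \<gamma>) =
         inverse (w + (((1 + w powr (1/\<alpha>)) powr \<alpha> - w) powr (1/\<gamma>)
                     + ((1 + w powr (1/\<beta>)) powr \<beta> - w) powr (1/\<gamma>)) powr \<gamma>)"
    using eta_13_vine_gauge[OF assms w] by (simp add: vine_gauge_def add.commute)
  assume "\<alpha> = \<beta>"
  then have w': "stationarity_lhs \<alpha> \<alpha> \<gamma> w = 0" using w by simp
  show "w = ((1 - 2 powr (- \<gamma>)) powr (- 1 / (1 - \<alpha>)) - 1) powr (- \<alpha>)"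
    by (rule symmetric_closed_form(1)[OF assms(1,2,5) w(1) w'])
  show "eta_13 (vine_gauge \<alpha> \<beta> \<gamma>) =
            ((1 - 2 powr (- \<gamma>)) powr (- 1 / (1 - \<alpha>)) - 1) powr \<alpha>
            / (1 - 2 powr \<gamma> + 2 powr \<gamma> * (1 - 2 powr (- \<gamma>)) powr (- \<alpha> / (1 - \<alpha>)))"
    using eta_13_vine_gauge[OF assms w] symmetric_closed_form(2)[OF assms(1,2,5) w(1) w'] \<open>\<alpha> = \<beta>\<close>
    by simp
qed

end
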